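(* Let $S$ be a Clifford semigroup equipped with a pseudo-norm $\|\cdot\|$. Then the pseudo-metrics $d_0$ and $d_1$ on $S$ defined by $$d_0(x,y)=\|x+y^*\|-\min(\|\delta x\|,\|\delta y\|),\qquad d_1(x,y)=\|x+y^*\|-\frac{\|\delta x\|+\|\delta y\|}{2}$$ are right-subinvariant and skew-convex.
   Context: Semigroups are written additively but are not assumed commutative. A semigroup $(S,+)$ is inverse if every $x\in S$ has a unique $x^*\in S$ with $x+x^*+x=x$ and $x^*+x+x^*=x^*$. $E(S)$ denotes the set of idempotents. The natural partial order is: $x\leqslant_S y$ iff $y=x+e$ for some $e\in E(S)$. Write $\delta x:=x+x^*$. An inverse semigroup is a Clifford semigroup if $x+x^*=x^*+x$ for all $x$. A pseudo-norm on an inverse semigroup $S$ is a map $\|\cdot\|:S\to\mathbb{R}_+$ such that for all $x,y,z\in S$: $\|x+y^*\|=\|y+x^*\|$; $\|x+x^*\|\leqslant\|x+y^*\|$; and $\|x+y^*\|+\|z+z^*\|\leqslant\|x+z^*\|+\|z+y^*\|$. A pseudo-metric $d:S\times S\to\mathbb{R}_+$ satisfies $d(x,x)=0$, symmetry and the triangle inequality. It is right-subinvariant if $d(x+y^*,z+y^* )\leqslant d(x,z)$ for all $x,y,z\in S$. On a Clifford semigroup it is skew-convex if (i) $d(x,y)\geqslant d(\delta x,\delta y)$ for all $x,y$, and (ii) $d(x,z)=d(\delta x,\delta y)+d(x+y^*,z+y^* )$ for all $x,y,z$ with $\delta x\leqslant_S\delta y\leqslant_S\delta z$. *)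

theory Defs
  imports Complex_Main
begin

class inverse_semigroup_add = semigroup_add +
  assumes ex1_star: "\<exists>!y. x + y + x = x \<and> y + x + y = y"
begin

definition star :: "'a \<Rightarrow> 'a"  ("_\<^sup>\<star>" [1000] 999)
  where "x\<^sup>\<star> = (THE y. x + y + x = x \<and> y + x + y = y)"

lemma star_props: "x + x\<^sup>\<star> + x = x" "x\<^sup>\<star> + x + x\<^sup>\<star> = x\<^sup>\<star>"
  using theI'[OF ex1_star[of x]] by (simp_all add: star_def)

lemma star_unique: "x + y + x = x \<Longrightarrow> y + x + y = y \<Longrightarrow> x\<^sup>\<star> = y"
  using ex1_star[of x] star_props[of x] by blast

definition idempotents :: "'a set"
  where "idempotents = {e. e + e = e}"

text \<open>The larger element is obtained from the smaller one by adding an idempotent, so on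
  idempotents this is the join-semilattice order, opposite to the multiplicative convention.\<close>

definition nat_le :: "'a \<Rightarrow> 'a \<Rightarrow> bool"  (infix "\<preceq>" 50)
  where "x \<preceq> y \<longleftrightarrow> (\<exists>e\<in>idempotents. y = x + e)"

definition delta :: "'a \<Rightarrow> 'a"  ("\<delta>")
  where "\<delta> x = x + x\<^sup>\<star>"

definition pseudo_norm :: "('a \<Rightarrow> real) \<Rightarrow> bool"
  where "pseudo_norm N \<longleftrightarrow>
    (\<forall>x. 0 \<le> N x) \<and>
    (\<forall>x y. N (x + y\<^sup>\<star>) = N (y + x\<^sup>\<star>)) \<and>
    (\<forall>x y. N (x + x\<^sup>\<star>) \<le> N (x + y\<^sup>\<star>)) \<and>
    (\<forall>x y z. N (x + y\<^sup>\<star>) + N (z + z\<^sup>\<star>) \<le> N (x + z\<^sup>\<star>) + N (z + y\<^sup>\<star>))"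

definition right_subinvariant :: "('a \<Rightarrow> 'a \<Rightarrow> real) \<Rightarrow> bool"
  where "right_subinvariant d \<longleftrightarrow> (\<forall>x y z. d (x + y\<^sup>\<star>) (z + y\<^sup>\<star>) \<le> d x z)"

definition d0 :: "('a \<Rightarrow> real) \<Rightarrow> 'a \<Rightarrow> 'a \<Rightarrow> real"
  where "d0 N x y = N (x + y\<^sup>\<star>) - min (N (\<delta> x)) (N (\<delta> y))"

definition d1 :: "('a \<Rightarrow> real) \<Rightarrow> 'a \<Rightarrow> 'a \<Rightarrow> real"
  where "d1 N x y = N (x + y\<^sup>\<star>) - (N (\<delta> x) + N (\<delta> y)) / 2"

end

class clifford_semigroup_add = inverse_semigroup_add +
  assumes star_commute: "x + x\<^sup>\<star> = x\<^sup>\<star> + x"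
begin

definition skew_convex :: "('a \<Rightarrow> 'a \<Rightarrow> real) \<Rightarrow> bool"
  where "skew_convex d \<longleftrightarrow>
    (\<forall>x y. d x y \<ge> d (\<delta> x) (\<delta> y)) \<and>
    (\<forall>x y z. \<delta> x \<preceq> \<delta> y \<and> \<delta> y \<preceq> \<delta> z \<longrightarrow>
      d x z = d (\<delta> x) (\<delta> y) + d (x + y\<^sup>\<star>) (z + y\<^sup>\<star>))"

end

definition pseudo_metric :: "('a \<Rightarrow> 'a \<Rightarrow> real) \<Rightarrow> bool"
  where "pseudo_metric d \<longleftrightarrow>
    (\<forall>x y. 0 \<le> d x y) \<and>
    (\<forall>x. d x x = 0) \<and>
    (\<forall>x y. d x y = d y x) \<and>
    (\<forall>x y z. d x z \<le> d x y + d y z)"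

end

theory Submission
  imports Defs
begin

text \<open>In a Clifford semigroup idempotents are central, so \<open>x + y\<^sup>\<star> + (z + y\<^sup>\<star>)\<^sup>\<star>\<close> equals
  \<open>x + \<delta> y + z\<^sup>\<star>\<close>. Right-subinvariance thus compares \<open>N (x + e + z\<^sup>\<star>)\<close> with \<open>N (x + z\<^sup>\<star>)\<close> for an
  idempotent \<open>e\<close>, and the increment is controlled by the quadrangle axiom of a pseudo-norm,
  applied to \<open>x + e, z, x\<close> and to \<open>x, z + e, z\<close>. In the skew-convexity identity the term
  \<open>\<delta> y\<close> is absorbed by \<open>z\<^sup>\<star>\<close>, and the norms of the idempotents telescope.\<close>

context inverse_semigroup_add
begin

section \<open>The involution and commuting idempotents\<close>

lemma star_star [simp]: "(x\<^sup>\<star>)\<^sup>\<star> = x"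
  by (rule star_unique) (simp_all add: star_props)

lemma star_idem: "e + e = e \<Longrightarrow> e\<^sup>\<star> = e"
  by (rule star_unique) simp_all

lemma delta_idem: "\<delta> x + \<delta> x = \<delta> x"
  using star_props(1)[of x] by (simp add: delta_def flip: add_assoc)

lemma delta_add_self: "\<delta> x + x = x"
  by (simp add: delta_def star_props)

lemma delta_of_idem: "e + e = e \<Longrightarrow> \<delta> e = e"
  by (simp add: delta_def star_idem)

lemma delta_delta [simp]: "\<delta> (\<delta> x) = \<delta> x"
  by (simp add: delta_of_idem delta_idem)

lemma star_delta [simp]: "(\<delta> x)\<^sup>\<star> = \<delta> x"
  by (simp add: star_idem delta_idem)

text \<open>By uniqueness of inverses the inverse \<open>x\<close> of \<open>e + f\<close> equals
  \<open>f + (x + e)\<close>, which makes it idempotent and so its own inverse; as the star is an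
  involution, \<open>e + f\<close> is \<open>x\<close>.\<close>

lemma idem_add_idem:
  assumes e: "e + e = e" and f: "f + f = f"
  shows "e + f + (e + f) = e + f"
proof -
  define x where "x = (e + f)\<^sup>\<star>"
  have e': "e + (e + a) = e + a" and f': "f + (f + a) = f + a" for a
    using e f by (simp_all flip: add_assoc)
  have x1: "e + (f + (x + (e + f))) = e + f" and x2: "x + (e + (f + x)) = x"
    using star_props[of "e + f"] by (simp_all add: x_def add_assoc)
  have x3: "x + (e + (f + (x + a))) = x + a" for a
    using arg_cong[OF x2, of "\<lambda>t. t + a"] by (simp add: add_assoc)
  have x: "x = f + (x + e)"
    unfolding x_def
    by (rule star_unique) (simp_all add: add_assoc e' f' x1 x3 flip: x_def)
  have "x + x = x"
  proof -
    have "x + x = f + (x + e) + (f + (x + e))"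
      using x by simp
    also have "\<dots> = f + (x + e)"
      by (simp add: add_assoc x3)
    finally show ?thesis
      using x by simp
  qed
  then have "x\<^sup>\<star> = x"
    by (rule star_idem)
  then have "e + f = x"
    by (simp add: x_def)
  with \<open>x + x = x\<close> show ?thesis
    by simp
qed

text \<open>Sums of idempotents are idempotent, so \<open>e + f\<close> and \<open>f + e\<close>
  both serve as inverse of \<open>e + f\<close>.\<close>

lemma idem_commute:
  assumes e: "e + e = e" and f: "f + f = f"
  shows "e + f = f + e"
proof -
  have e': "e + (e + a) = e + a" and f': "f + (f + a) = f + a" for a
    using e f by (simp_all flip: add_assoc)
  have ef: "e + (f + (e + f)) = e + f" and fe: "f + (e + (f + e)) = f + e"
    using idem_add_idem[OF e f] idem_add_idem[OF f e] by (simp_all add: add_assoc)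
  have "(e + f)\<^sup>\<star> = f + e"
    by (rule star_unique) (simp_all add: add_assoc e' f' ef fe)
  moreover have "(e + f)\<^sup>\<star> = e + f"
    by (rule star_idem) (rule idem_add_idem[OF e f])
  ultimately show ?thesis
    by simp
qed

lemma star_add: "(x + y)\<^sup>\<star> = y\<^sup>\<star> + x\<^sup>\<star>"
proof -
  \<comment> \<open>Here \<open>\<delta> (x\<^sup>\<star>)\<close> is
    \<open>x\<^sup>\<star> + x\<close>. Swapping it with \<open>\<delta> y\<close> regroups each
    word so that the inverse laws for \<open>x\<close> and \<open>y\<close> apply
    separately.\<close>
  have c: "\<delta> (x\<^sup>\<star>) + \<delta> y = \<delta> y + \<delta> (x\<^sup>\<star>)" for x y
    by (rule idem_commute) (rule delta_idem)+
  have "x + y + (y\<^sup>\<star> + x\<^sup>\<star>) + (x + y) = x + (\<delta> y + \<delta> (x\<^sup>\<star>)) + y"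
    by (simp add: delta_def add_assoc)
  also have "\<dots> = x + x\<^sup>\<star> + x + (y + y\<^sup>\<star> + y)"
    by (simp add: c[symmetric]) (simp add: delta_def add_assoc)
  finally have 1: "x + y + (y\<^sup>\<star> + x\<^sup>\<star>) + (x + y) = x + y"
    by (simp add: star_props)
  have "y\<^sup>\<star> + x\<^sup>\<star> + (x + y) + (y\<^sup>\<star> + x\<^sup>\<star>) = y\<^sup>\<star> + (\<delta> (x\<^sup>\<star>) + \<delta> y) + x\<^sup>\<star>"
    by (simp add: delta_def add_assoc)
  also have "\<dots> = y\<^sup>\<star> + y + y\<^sup>\<star> + (x\<^sup>\<star> + x + x\<^sup>\<star>)"
    by (simp add: c) (simp add: delta_def add_assoc)
  finally have 2: "y\<^sup>\<star> + x\<^sup>\<star> + (x + y) + (y\<^sup>\<star> + x\<^sup>\<star>) = y\<^sup>\<star> + x\<^sup>\<star>"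
    by (simp add: star_props)
  from 1 2 show ?thesis
    by (rule star_unique)
qed

lemma nat_le_delta_absorb:
  assumes "\<delta> x \<preceq> \<delta> y"
  shows "\<delta> x + \<delta> y = \<delta> y" "\<delta> y + \<delta> x = \<delta> y"
proof -
  from assms obtain e where "\<delta> y = \<delta> x + e"
    by (auto simp: nat_le_def)
  then show "\<delta> x + \<delta> y = \<delta> y"
    using delta_idem[of x] by (simp flip: add_assoc)
  then show "\<delta> y + \<delta> x = \<delta> y"
    using idem_commute[OF delta_idem delta_idem, of y x] by simp
qed

section \<open>Pseudo-norms and the pseudo-metric axioms\<close>

lemma pseudo_norm_commute: "pseudo_norm N \<Longrightarrow> N (x + y\<^sup>\<star>) = N (y + x\<^sup>\<star>)"
  by (simp add: pseudo_norm_def)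

lemma pseudo_norm_delta_le:
  assumes "pseudo_norm N"
  shows "N (\<delta> x) \<le> N (x + y\<^sup>\<star>)" "N (\<delta> y) \<le> N (x + y\<^sup>\<star>)"
proof -
  show *: "N (\<delta> x) \<le> N (x + y\<^sup>\<star>)" for x y
    using assms by (simp add: pseudo_norm_def delta_def)
  show "N (\<delta> y) \<le> N (x + y\<^sup>\<star>)"
    using *[of y x] pseudo_norm_commute[OF assms, of x y] by simp
qed

lemma pseudo_norm_quadrangle:
  assumes "pseudo_norm N"
  shows "N (x + y\<^sup>\<star>) + N (\<delta> z) \<le> N (x + z\<^sup>\<star>) + N (z + y\<^sup>\<star>)"
proof -
  from assms have "\<forall>x y z. N (x + y\<^sup>\<star>) + N (\<delta> z) \<le> N (x + z\<^sup>\<star>) + N (z + y\<^sup>\<star>)"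
    unfolding pseudo_norm_def delta_def by (elim conjE)
  then show ?thesis
    by (elim allE)
qed

lemma pseudo_metric_d0:
  assumes "pseudo_norm N"
  shows "pseudo_metric (d0 N)"
  unfolding pseudo_metric_def
proof (intro conjI allI)
  fix x y z
  show "0 \<le> d0 N x y"
    using pseudo_norm_delta_le(1)[OF assms, of x y] by (simp add: d0_def min_def)
  show "d0 N x x = 0"
    by (simp add: d0_def delta_def)
  show "d0 N x y = d0 N y x"
    using pseudo_norm_commute[OF assms, of x y] by (simp add: d0_def min.commute)
  \<comment> \<open>With \<open>a\<close>, \<open>b\<close>, \<open>c\<close> the norms of
    \<open>\<delta> x\<close>, \<open>\<delta> y\<close>, \<open>\<delta> z\<close>, it remains to
    see \<open>min a b + min b c \<le> b + min a c\<close>.\<close>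
  show "d0 N x z \<le> d0 N x y + d0 N y z"
    using pseudo_norm_quadrangle[OF assms, of x z y] by (simp add: d0_def min_def)
qed

lemma pseudo_metric_d1:
  assumes "pseudo_norm N"
  shows "pseudo_metric (d1 N)"
  unfolding pseudo_metric_def
proof (intro conjI allI)
  fix x y z
  show "0 \<le> d1 N x y"
    using pseudo_norm_delta_le[OF assms, where x = x and y = y] by (simp add: d1_def)
  show "d1 N x x = 0"
    by (simp add: d1_def delta_def)
  show "d1 N x y = d1 N y x"
    using pseudo_norm_commute[OF assms, of x y] by (simp add: d1_def add.commute)
  \<comment> \<open>The two halves of \<open>N (\<delta> y)\<close> on the right add up to its term
    in the quadrangle inequality.\<close>
  show "d1 N x z \<le> d1 N x y + d1 N y z"
    using pseudo_norm_quadrangle[OF assms, of x z y] by (simp add: d1_def field_simps)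
qed

end

context clifford_semigroup_add
begin

section \<open>Central idempotents in Clifford semigroups\<close>

lemma delta_star [simp]: "\<delta> (x\<^sup>\<star>) = \<delta> x"
  by (simp add: delta_def star_commute)

lemma add_delta_self: "x + \<delta> x = x"
  unfolding delta_def star_commute by (simp add: star_props flip: add_assoc)

text \<open>The Clifford law for \<open>e + x\<close> yields
  \<open>x\<^sup>\<star> + e + x = \<delta> x + e\<close>; adding \<open>x\<close> on the left turns
  this into centrality.\<close>

lemma idem_central:
  assumes e: "e + e = e"
  shows "e + x = x + e"
proof -
  have ed: "\<delta> x + e = e + \<delta> x"
    using delta_idem e by (rule idem_commute)
  have e': "e + (e + a) = e + a" for a
    using e by (simp flip: add_assoc)
  have "x\<^sup>\<star> + e + x = (e + x)\<^sup>\<star> + (e + x)"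
    by (simp add: star_add star_idem[OF e] e' add_assoc)
  also have "\<dots> = (e + x) + (e + x)\<^sup>\<star>"
    by (rule star_commute[symmetric])
  also have "\<dots> = e + \<delta> x + e"
    by (simp add: star_add star_idem[OF e] delta_def add_assoc)
  also have "\<dots> = \<delta> x + e"
    using e by (simp add: ed[symmetric] add_assoc)
  finally have conj: "x\<^sup>\<star> + e + x = \<delta> x + e" .
  have "e + x = e + \<delta> x + x"
    by (simp add: delta_add_self add_assoc)
  also have "\<dots> = x + (x\<^sup>\<star> + e + x)"
    by (simp add: ed[symmetric]) (simp add: delta_def add_assoc)
  also have "\<dots> = x + e"
    by (simp add: conj add_delta_self flip: add_assoc)
  finally show ?thesis .
qed

lemma delta_add: "\<delta> (x + y) = \<delta> x + \<delta> y"
proof -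
  have c: "x + \<delta> y = \<delta> y + x"
    by (rule idem_central[OF delta_idem, symmetric])
  have "\<delta> (x + y) = x + \<delta> y + x\<^sup>\<star>"
    by (simp add: delta_def star_add add_assoc)
  also have "\<dots> = \<delta> y + \<delta> x"
    unfolding c by (simp add: delta_def add_assoc)
  also have "\<dots> = \<delta> x + \<delta> y"
    by (rule idem_central[OF delta_idem])
  finally show ?thesis .
qed

lemma add_star_add_star: "x + y\<^sup>\<star> + (z + y\<^sup>\<star>)\<^sup>\<star> = x + \<delta> y + z\<^sup>\<star>"
  unfolding delta_def star_commute[of y] by (simp add: star_add add_assoc)

section \<open>Norm estimates\<close>

lemma pseudo_norm_delta_le_self:
  assumes "pseudo_norm N"
  shows "N (\<delta> x) \<le> N x"
  using pseudo_norm_delta_le(1)[OF assms, of x "\<delta> x"] by (simp add: add_delta_self)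

text \<open>The left side is the norm of \<open>\<delta> (x + y\<^sup>\<star>)\<close> and also the
  one occurring in the distance from \<open>\<delta> x\<close> to \<open>\<delta> y\<close>, as
  skew-convexity (i) requires.\<close>

lemma pseudo_norm_delta_add_delta_le:
  assumes "pseudo_norm N"
  shows "N (\<delta> x + \<delta> y) \<le> N (x + y\<^sup>\<star>)"
  using pseudo_norm_delta_le_self[OF assms, of "x + y\<^sup>\<star>"] by (simp add: delta_add)

lemma pseudo_norm_delta_mono:
  assumes "pseudo_norm N" "\<delta> x \<preceq> \<delta> y"
  shows "N (\<delta> x) \<le> N (\<delta> y)"
  using pseudo_norm_delta_le(1)[OF assms(1), of "\<delta> x" "\<delta> y"] nat_le_delta_absorb(1)[OF assms(2)]
  by simp

lemma pseudo_norm_insert_idem: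
  assumes N: "pseudo_norm N" and e: "e + e = e"
  shows "N (x + e + z\<^sup>\<star>) + N (\<delta> x) \<le> N (x + z\<^sup>\<star>) + N (\<delta> x + e)"
    and "N (x + e + z\<^sup>\<star>) + N (\<delta> z) \<le> N (x + z\<^sup>\<star>) + N (\<delta> z + e)"
proof -
  have "x + e + x\<^sup>\<star> = \<delta> x + e" for x
    by (simp add: delta_def add_assoc idem_central[OF e])
  then show "N (x + e + z\<^sup>\<star>) + N (\<delta> x) \<le> N (x + z\<^sup>\<star>) + N (\<delta> x + e)"
    using pseudo_norm_quadrangle[OF N, of "x + e" z x] by simp
  have "x + (z + e)\<^sup>\<star> = x + e + z\<^sup>\<star>" for x
    by (simp add: star_add star_idem[OF e] add_assoc)
  moreover have "z + e + z\<^sup>\<star> = \<delta> z + e"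
    by (simp add: delta_def add_assoc idem_central[OF e])
  ultimately show "N (x + e + z\<^sup>\<star>) + N (\<delta> z) \<le> N (x + z\<^sup>\<star>) + N (\<delta> z + e)"
    using pseudo_norm_quadrangle[OF N, of x "z + e" z] by simp
qed

section \<open>Right-subinvariance\<close>

lemma right_subinvariant_d0:
  assumes "pseudo_norm N"
  shows "right_subinvariant (d0 N)"
  unfolding right_subinvariant_def
proof (intro allI)
  fix x y z
  show "d0 N (x + y\<^sup>\<star>) (z + y\<^sup>\<star>) \<le> d0 N x z"
    \<comment> \<open>Whichever of \<open>x\<close>, \<open>z\<close> attains the minimum on the
      left selects the bound to use.\<close>
    using pseudo_norm_insert_idem[OF assms delta_idem[of y], where x = x and z = z]
    by (simp add: d0_def add_star_add_star delta_add min_def)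
qed

lemma right_subinvariant_d1:
  assumes "pseudo_norm N"
  shows "right_subinvariant (d1 N)"
  unfolding right_subinvariant_def
proof (intro allI)
  fix x y z
  show "d1 N (x + y\<^sup>\<star>) (z + y\<^sup>\<star>) \<le> d1 N x z"
    \<comment> \<open>The claim is the mean of the two bounds.\<close>
    using pseudo_norm_insert_idem[OF assms delta_idem[of y], where x = x and z = z]
    by (simp add: d1_def add_star_add_star delta_add add_divide_distrib)
qed

section \<open>Skew-convexity\<close>

lemma add_delta_add_star_absorb:
  assumes "\<delta> y \<preceq> \<delta> z"
  shows "x + \<delta> y + z\<^sup>\<star> = x + z\<^sup>\<star>"
proof -
  \<comment> \<open>Since \<open>\<delta> (z\<^sup>\<star>)\<close> is \<open>\<delta> z\<close>,
    the latter is a left identity for \<open>z\<^sup>\<star>\<close> and can absorb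
    \<open>\<delta> y\<close>.\<close>
  have "\<delta> y + z\<^sup>\<star> = \<delta> y + \<delta> z + z\<^sup>\<star>"
    using delta_add_self[of "z\<^sup>\<star>"] by (simp add: add_assoc)
  also have "\<dots> = z\<^sup>\<star>"
    using delta_add_self[of "z\<^sup>\<star>"] by (simp add: nat_le_delta_absorb(1)[OF assms])
  finally show ?thesis
    by (simp add: add_assoc)
qed

lemma skew_convex_d0:
  assumes "pseudo_norm N"
  shows "skew_convex (d0 N)"
  unfolding skew_convex_def
proof (intro conjI allI impI)
  fix x y z
  show "d0 N x y \<ge> d0 N (\<delta> x) (\<delta> y)"
    using pseudo_norm_delta_add_delta_le[OF assms, of x y] by (simp add: d0_def)
  assume "\<delta> x \<preceq> \<delta> y \<and> \<delta> y \<preceq> \<delta> z"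
  then have xy: "\<delta> x \<preceq> \<delta> y" and yz: "\<delta> y \<preceq> \<delta> z"
    by auto
  \<comment> \<open>Monotonicity decides every minimum: the right side becomes
    \<open>N (\<delta> y) - N (\<delta> x)\<close> plus
    \<open>N (x + z\<^sup>\<star>) - N (\<delta> y)\<close>.\<close>
  then show "d0 N x z = d0 N (\<delta> x) (\<delta> y) + d0 N (x + y\<^sup>\<star>) (z + y\<^sup>\<star>)"
    using pseudo_norm_delta_mono[OF assms xy] pseudo_norm_delta_mono[OF assms yz]
    by (simp add: d0_def add_star_add_star delta_add add_delta_add_star_absorb
        nat_le_delta_absorb)
qed

lemma skew_convex_d1:
  assumes "pseudo_norm N"
  shows "skew_convex (d1 N)"
  unfolding skew_convex_def
proof (intro conjI allI impI)
  fix x y z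
  show "d1 N x y \<ge> d1 N (\<delta> x) (\<delta> y)"
    using pseudo_norm_delta_add_delta_le[OF assms, of x y] by (simp add: d1_def)
  assume "\<delta> x \<preceq> \<delta> y \<and> \<delta> y \<preceq> \<delta> z"
  \<comment> \<open>The first distance on the right is half of
    \<open>N (\<delta> y) - N (\<delta> x)\<close>; it replaces \<open>\<delta> y\<close> by
    \<open>\<delta> x\<close> in the mean of the second.\<close>
  then show "d1 N x z = d1 N (\<delta> x) (\<delta> y) + d1 N (x + y\<^sup>\<star>) (z + y\<^sup>\<star>)"
    by (simp add: d1_def add_star_add_star delta_add add_delta_add_star_absorb
        nat_le_delta_absorb add_divide_distrib)
qed

end

theorem proposition7p4:
  fixes N :: "'a::clifford_semigroup_add \<Rightarrow> real"
  assumes "pseudo_norm N"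
  shows "pseudo_metric (d0 N) \<and> right_subinvariant (d0 N) \<and> skew_convex (d0 N) \<and>
         pseudo_metric (d1 N) \<and> right_subinvariant (d1 N) \<and> skew_convex (d1 N)"
  using assms
  by (simp add: pseudo_metric_d0 right_subinvariant_d0 skew_convex_d0
      pseudo_metric_d1 right_subinvariant_d1 skew_convex_d1)

end
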